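(* Let $U, Y, V_U, J, S, \widehat{J}, \phi, U_{\mathrm{ad}}, \psi$ and, for each $h>0$, $U_h, Y_h, S_h, \widehat{J}_h, \widehat{j}_h, \psi_h, \Pi_h$ be as described in the context; in particular $\psi=\phi+I_{U_{\mathrm{ad}}}$ and $\psi_h=\phi+I_{\Pi_hU_{\mathrm{ad}}}$ on $U_h$. Suppose that $\phi(\Pi_hu)\le\phi(u)$ for all $h>0$ and $u\in U$. Suppose further the following. (1) $\widehat{U}$ is a real reflexive Banach space, $\widehat{U}\subset U$, and the map $\iota_{\widehat{U},U}\colon\widehat{U}\to U$, $w\mapsto w$, is continuous with dense image in $U$. There is a nondecreasing function $\rho_{\Pi}\colon[0,\infty)\to[0,\infty)$ with $\rho_\Pi(0)=0$ and $\|\Pi_h v-v\|_U\le\rho_\Pi(h)\|v\|_{\widehat{U}}$ for all $v\in\widehat{U}$ and $h>0$. (2) $W_U\subset V_U$ is a bounded set with $\mathrm{dom}(\psi)\subset W_U$ and $\mathrm{dom}(\psi_h)\subset W_U$ for all $h>0$. The gradient $\nabla\widehat{J}$ is Lipschitz continuous on $W_U$ with Lipschitz constant $L_{\nabla\widehat{J}}>0$. There is $\ell_{\nabla\widehat{J}}>0$ such that for all $h>0$ and $v_h\in W_U\cap U_h$, $\nabla\widehat{J}(v_h)\in\widehat{U}$ and $\|\nabla\widehat{J}(v_h)\|_{\widehat{U}}\le\ell_{\nabla\widehat{J}}$. There is a nondecreasing function $\rho_{\nabla\widehat{J}}\colon[0,\infty)\to[0,\infty)$ with $\rho_{\nabla\widehat{J}}(0)=0$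 and $\|\nabla\widehat{J}_h(v_h)-\nabla\widehat{J}(v_h)\|_U\le\rho_{\nabla\widehat{J}}(h)$ for all $v_h\in W_U\cap U_h$ and $h>0$. (3) There is a nondecreasing function $\rho_{\mathrm{proj}}\colon[0,\infty)\to[0,\infty)$ with $\rho_{\mathrm{proj}}(0)=0$ and $\|\mathrm{proj}_{U_{\mathrm{ad}}}(v_h)-\mathrm{proj}_{\Pi_hU_{\mathrm{ad}}}(v_h)\|_U\le\rho_{\mathrm{proj}}(h)$ for all $v_h\in U_h$ and $h>0$. Let $L_\phi$ be the Lipschitz constant of $\phi$ on $W_U$, and let $\mathrm{diam}(W_U)$ be the diameter of $W_U$. Then for all $h>0$ and $u_h\in W_U\cap U_h$, with $\bar u_h=\mathrm{proj}_{U_{\mathrm{ad}}}(u_h)$, $$\chi_{\mathrm{gap}}(\bar u_h)\le\chi_{\mathrm{gap},h}(u_h)+(\ell_{\nabla\widehat{J}}+L_\phi)\,\rho_{\mathrm{proj}}(h)+\mathrm{diam}(W_U)\big[L_{\nabla\widehat{J}}\,\rho_{\mathrm{proj}}(h)+\rho_\Pi(h)\,\ell_{\nabla\widehat{J}}+\rho_{\nabla\widehat{J}}(h)\big].$$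
   Context: Setting. $U$ is a real separable Hilbert space and $Y$ a real separable Banach space. $\phi\colon U\to\mathbb{R}$ is a real-valued convex function, assumed Lipschitz continuous on the bounded set $W_U$ of the claim. $U_{\mathrm{ad}}\subset U$ is closed, convex, bounded and nonempty. $I_C$ is the indicator function of a set $C$ ($0$ on $C$, $\infty$ off $C$). $\psi\colon U\to(-\infty,\infty]$, $\psi(u)=\phi(u)+I_{U_{\mathrm{ad}}}(u)$, is proper, closed (lower semicontinuous) and convex; $\mathrm{dom}(\psi)=\{u:\psi(u)<\infty\}=U_{\mathrm{ad}}$. $V_U\subset U$ is open with $\mathrm{dom}(\psi)\subset V_U$. $J\colon Y\times U\to\mathbb{R}$ and $S\colon V_U\to Y$ are continuously differentiable. Define $\widehat{J}\colon V_U\to\mathbb{R}$, $\widehat{J}(u)=J(S(u),u)$. Discretization. For each $h>0$, $U_h$ is a closed linear subspace of $U$ (with the inner product of $U$), $Y_h$ is a linear subspace of $Y$ (with the norm of $Y$), $\Pi_h\colon U\to U_h$ is the orthogonal projection onto $U_h$, and $\psi_h\colon U_h\to(-\infty,\infty]$, $\psi_h(u_h)=\phi(u_h)+I_{\Pi_hU_{\mathrm{ad}}}(u_h)$, is proper, closed and convex with $\mathrm{dom}(\psi_h)=\Pi_hU_{\mathrm{ad}}\subset V_U$. $S_h\colon V_U\to Y_h$ is continuously differentiable. Define $\widehat{J}_h\colon V_U\to\mathbb{R}$, $\widehat{J}_h(u)=J(S_h(u),u)$, and $\widehat{j}_h\colon U_h\cap V_U\to\mathbb{R}$, $\widehat{j}_h(u_h)=\widehat{J}_h(u_h)$.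 Gradients $\nabla\widehat{J},\nabla\widehat{J}_h$ are Riesz representatives of the derivatives in $U$; $\nabla\widehat{j}_h$ is the Riesz representative in $U_h$; one has $\nabla\widehat{j}_h(u_h)=\Pi_h\nabla\widehat{J}_h(u_h)$. $\mathrm{proj}_C$ is the metric projection onto a closed convex nonempty set $C$. Gap functions. $\chi_{\mathrm{gap}}\colon V_U\to(-\infty,\infty]$, $\chi_{\mathrm{gap}}(u)=\sup_{v\in U_{\mathrm{ad}}}\{(\nabla\widehat{J}(u),u-v)_U+\phi(u)-\phi(v)\}$, and $\chi_{\mathrm{gap},h}\colon V_U\cap U_h\to(-\infty,\infty]$, $\chi_{\mathrm{gap},h}(u_h)=\sup_{v_h\in\Pi_hU_{\mathrm{ad}}}\{(\nabla\widehat{j}_h(u_h),u_h-v_h)_U+\phi(u_h)-\phi(v_h)\}$.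
   Formalization: The claim as worded is false; the formal theorem takes u_h in dom(psi_h)=Pi_h U_ad rather than in all of W_U ∩ U_h, and assumes that the embedding of Û into U has norm at most 1, so that the bound on the Û-norm of the gradient also bounds its U-norm. *)

theory Defs
  imports "HOL-Analysis.Analysis"
begin

section \<open>Extended-real-valued convex functions\<close>

definition indicator_fun :: "'a set \<Rightarrow> 'a \<Rightarrow> ereal" where
  "indicator_fun C u = (if u \<in> C then 0 else \<infinity>)"

definition plus_indicator :: "('a \<Rightarrow> real) \<Rightarrow> 'a set \<Rightarrow> 'a \<Rightarrow> ereal" where
  "plus_indicator \<phi> C u = ereal (\<phi> u) + indicator_fun C u"

text \<open>In the following notions the function is regarded as defined on \<open>M\<close> only; its values
  outside \<open>M\<close> play no role.\<close>

definition effective_domain :: "'a set \<Rightarrow> ('a \<Rightarrow> ereal) \<Rightarrow> 'a set" where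
  "effective_domain M f = {u \<in> M. f u < \<infinity>}"

definition proper_on :: "'a set \<Rightarrow> ('a \<Rightarrow> ereal) \<Rightarrow> bool" where
  "proper_on M f \<longleftrightarrow> effective_domain M f \<noteq> {} \<and> (\<forall>u\<in>M. f u \<noteq> -\<infinity>)"

definition lower_semicontinuous_on :: "'a::topological_space set \<Rightarrow> ('a \<Rightarrow> ereal) \<Rightarrow> bool" where
  "lower_semicontinuous_on M f \<longleftrightarrow> (\<forall>u\<in>M. f u \<le> Liminf (at u within M) f)"

definition ereal_convex_on :: "'a::real_vector set \<Rightarrow> ('a \<Rightarrow> ereal) \<Rightarrow> bool" where
  "ereal_convex_on M f \<longleftrightarrow> convex {(u, r::real). u \<in> M \<and> f u \<le> ereal r}"


section \<open>Banach and Hilbert space notions\<close>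

text \<open>The canonical embedding into the bidual is onto. The argument only carries the type.\<close>

definition reflexive_space :: "'a::real_normed_vector itself \<Rightarrow> bool" where
  "reflexive_space _ \<longleftrightarrow>
     (\<forall>\<Phi> :: ('a \<Rightarrow>\<^sub>L real) \<Rightarrow>\<^sub>L real. \<exists>x::'a. \<forall>f. blinfun_apply \<Phi> f = blinfun_apply f x)"

text \<open>Continuous differentiability as a map from the open set \<open>V\<close> into the normed space \<open>Z\<close>,
  a linear subspace of the ambient type. As \<open>Z\<close> need not be closed, it has to be required
  that the derivatives take their values in \<open>Z\<close>.\<close>

definition C1_into ::
    "('a::real_normed_vector \<Rightarrow> 'b::real_normed_vector) \<Rightarrow> 'a set \<Rightarrow> 'b set \<Rightarrow> bool" where
  "C1_into f V Z \<longleftrightarrow>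
     (\<exists>f' :: 'a \<Rightarrow> 'a \<Rightarrow>\<^sub>L 'b. continuous_on V f' \<and>
        (\<forall>u\<in>V. f u \<in> Z \<and> range (blinfun_apply (f' u)) \<subseteq> Z \<and>
               (f has_derivative blinfun_apply (f' u)) (at u)))"

definition gradient :: "('a::real_inner \<Rightarrow> real) \<Rightarrow> 'a \<Rightarrow> 'a" where
  "gradient f u = (THE g. GDERIV f u :> g)"

text \<open>The gradient at \<open>u \<in> M\<close> of the restriction of \<open>f\<close> to the Hilbert space \<open>M\<close>, a closed
  linear subspace: the Riesz representative in \<open>M\<close> of the derivative on \<open>M\<close>.\<close>

definition subspace_gradient :: "'a::real_inner set \<Rightarrow> ('a \<Rightarrow> real) \<Rightarrow> 'a \<Rightarrow> 'a" where
  "subspace_gradient M f u =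
     (THE g. g \<in> M \<and> (f has_derivative (\<lambda>d. inner d g)) (at u within M))"

definition orthogonal_projection :: "'a::real_inner set \<Rightarrow> 'a \<Rightarrow> 'a" where
  "orthogonal_projection M u = (THE p. p \<in> M \<and> (\<forall>m\<in>M. inner (u - p) m = 0))"

text \<open>The library's \<open>closest_point\<close> is confined to locally compact spaces.\<close>

definition metric_projection :: "'a::metric_space set \<Rightarrow> 'a \<Rightarrow> 'a" where
  "metric_projection C u = (THE p. p \<in> C \<and> (\<forall>v\<in>C. dist u p \<le> dist u v))"


section \<open>Reduced objective and gap functions\<close>

definition reduced_objective :: "('y \<times> 'u \<Rightarrow> real) \<Rightarrow> ('u \<Rightarrow> 'y) \<Rightarrow> 'u \<Rightarrow> real" where
  "reduced_objective J S u = J (S u, u)"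

definition gap :: "('u::real_inner \<Rightarrow> real) \<Rightarrow> ('u \<Rightarrow> real) \<Rightarrow> 'u set \<Rightarrow> 'u \<Rightarrow> ereal" where
  "gap Jhat \<phi> Uad u =
     (SUP v\<in>Uad. ereal (inner (gradient Jhat u) (u - v) + \<phi> u - \<phi> v))"

definition discrete_gap ::
    "'u::real_inner set \<Rightarrow> ('u \<Rightarrow> real) \<Rightarrow> ('u \<Rightarrow> real) \<Rightarrow> 'u set \<Rightarrow> 'u \<Rightarrow> ereal" where
  "discrete_gap M Jhat \<phi> Uad u =
     (SUP v\<in>orthogonal_projection M ` Uad.
        ereal (inner (subspace_gradient M Jhat u) (u - v) + \<phi> u - \<phi> v))"

text \<open>Nondecreasing functions from \<open>[0,\<infinity>)\<close> to \<open>[0,\<infinity>)\<close> vanishing at 0.\<close>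

definition rate_function :: "(real \<Rightarrow> real) \<Rightarrow> bool" where
  "rate_function \<rho> \<longleftrightarrow> mono_on {0..} \<rho> \<and> (\<forall>t\<ge>0. 0 \<le> \<rho> t) \<and> \<rho> 0 = 0"

end

theory Submission
  imports Defs
begin

text \<open>Write \<open>g\<close> for the gradient of the reduced objective at the discrete point \<open>u\<^sub>h\<close>, and compare the
  gap at the projected point with the discrete gap for a fixed competitor \<open>v\<close>, which is tested
  discretely with \<open>\<Pi>v\<close>. Replacing the projected point by \<open>u\<^sub>h\<close> and \<open>g\<close> by the discrete gradient
  costs only Lipschitz and approximation errors. The remaining term is
  \<open>(g, \<Pi>v - v) = (g - \<Pi>g, u\<^sub>h - v)\<close>, because \<open>g - \<Pi>g\<close> is orthogonal to \<open>u\<^sub>h - \<Pi>v\<close>; in this form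
  the approximation property applies to the regular function \<open>g\<close> rather than to \<open>v\<close>.\<close>

section \<open>Projections in Hilbert space\<close>

text \<open>Parallelogram law for \<open>u - p\<close> and \<open>u - q\<close>, whose mean is
  \<open>u - midpoint p q\<close> and whose difference has norm \<open>dist p q\<close>.\<close>

lemma dist_midpoint_parallelogram:
  fixes p q u :: "'a::real_inner"
  shows "(dist p q)\<^sup>2 = 2 * (dist u p)\<^sup>2 + 2 * (dist u q)\<^sup>2 - 4 * (dist u (midpoint p q))\<^sup>2"
proof -
  have "u - midpoint p q = (1/2) *\<^sub>R ((u - p) + (u - q))"
    by (simp add: midpoint_def algebra_simps flip: scaleR_add_left)
  then have "4 * (dist u (midpoint p q))\<^sup>2 = (norm ((u - p) + (u - q)))\<^sup>2"
    by (simp add: dist_norm power_divide)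
  moreover have "(dist p q)\<^sup>2 = (norm ((u - p) - (u - q)))\<^sup>2"
    by (simp add: dist_norm norm_minus_commute)
  ultimately show ?thesis
    by (simp add: dist_norm power2_norm_eq_inner inner_simps inner_commute)
qed

text \<open>By convexity the midpoint of \<open>p\<close> and \<open>q\<close> is no closer to
  \<open>u\<close> than \<open>infdist u C\<close>, so the parallelogram law leaves only the two
  errors \<open>2 * e\<close>. Used with \<open>e = 0\<close> for uniqueness of nearest points and
  with small \<open>e\<close> for the Cauchy property of minimizing sequences.\<close>

lemma dist_near_infdist:
  fixes C :: "'a::real_inner set"
  assumes "convex C" "p \<in> C" "q \<in> C"
    and "(dist u p)\<^sup>2 \<le> (infdist u C)\<^sup>2 + e" "(dist u q)\<^sup>2 \<le> (infdist u C)\<^sup>2 + e"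
  shows "(dist p q)\<^sup>2 \<le> 4 * e"
proof -
  have "midpoint p q \<in> C"
    using convexD[OF assms(1-3), of "1/2" "1/2"] by (simp add: midpoint_def scaleR_add_right)
  then have "infdist u C \<le> dist u (midpoint p q)"
    by (rule infdist_le)
  then have "(infdist u C)\<^sup>2 \<le> (dist u (midpoint p q))\<^sup>2"
    by (simp add: infdist_nonneg power_mono)
  then show ?thesis
    using assms(4,5) dist_midpoint_parallelogram[of p q u] by linarith
qed

lemma nearest_point_unique:
  fixes C :: "'a::real_inner set"
  assumes "convex C" "p \<in> C" "q \<in> C"
    and "\<forall>v\<in>C. dist u p \<le> dist u v" "\<forall>v\<in>C. dist u q \<le> dist u v"
  shows "p = q"
proof -
  have "infdist u C = dist u r" if "r \<in> C" "\<forall>v\<in>C. dist u r \<le> dist u v" for r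
    using that infdist_le[OF \<open>r \<in> C\<close>, of u]
    by (intro antisym) (auto simp: infdist_def intro!: cINF_greatest)
  then have "(dist p q)\<^sup>2 \<le> 4 * 0"
    using assms by (intro dist_near_infdist[where C = C and u = u]) auto
  then show ?thesis
    by simp
qed

text \<open>A minimizing sequence is Cauchy by \<open>dist_near_infdist\<close>; completeness
  provides its limit and closedness keeps the limit in \<open>C\<close>.\<close>

lemma nearest_point_exists:
  fixes C :: "'a::{real_inner,complete_space} set"
  assumes "closed C" "convex C" "C \<noteq> {}"
  shows "\<exists>p\<in>C. \<forall>v\<in>C. dist u p \<le> dist u v"
proof -
  let ?d = "infdist u C"
  \<comment> \<open>The slack is put on the squared distance, as \<open>dist_near_infdist\<close>
    requires.\<close>
  have "\<exists>p\<in>C. (dist u p)\<^sup>2 \<le> ?d\<^sup>2 + e" if "e > 0" for e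
  proof -
    have "?d < sqrt (?d\<^sup>2 + e)"
      using that by (intro real_less_rsqrt) simp
    then have "\<not> (\<forall>p\<in>C. sqrt (?d\<^sup>2 + e) \<le> dist u p)"
      using \<open>C \<noteq> {}\<close> cINF_greatest[of C "sqrt (?d\<^sup>2 + e)" "dist u"]
      by (auto simp: infdist_notempty)
    then obtain p where p: "p \<in> C" "dist u p < sqrt (?d\<^sup>2 + e)"
      by force
    have "(dist u p)\<^sup>2 \<le> (sqrt (?d\<^sup>2 + e))\<^sup>2"
      using p(2) by (intro power_mono) auto
    then show ?thesis
      using p(1) that by auto
  qed
  then have "\<forall>n. \<exists>p\<in>C. (dist u p)\<^sup>2 \<le> ?d\<^sup>2 + inverse (real (Suc n))"
    by simp
  then obtain X where X: "\<And>n. X n \<in> C"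
      "\<And>n. (dist u (X n))\<^sup>2 \<le> ?d\<^sup>2 + inverse (real (Suc n))"
    by metis
  have "Cauchy X"
  proof (rule metric_CauchyI)
    fix e :: real assume "e > 0"
    \<comment> \<open>The 4 cancels the factor in \<open>dist_near_infdist\<close>.\<close>
    then obtain N where N: "inverse (real (Suc N)) < e\<^sup>2 / 4"
      using reals_Archimedean[of "e\<^sup>2 / 4"] by auto
    have near: "(dist u (X n))\<^sup>2 \<le> ?d\<^sup>2 + inverse (real (Suc N))" if "n \<ge> N" for n
    proof -
      have "inverse (real (Suc n)) \<le> inverse (real (Suc N))"
        using that by (intro le_imp_inverse_le) auto
      then show ?thesis
        using X(2)[of n] by linarith
    qed
    have "dist (X m) (X n) < e" if "m \<ge> N" "n \<ge> N" for m n
    proof -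
      have "(dist (X m) (X n))\<^sup>2 \<le> 4 * inverse (real (Suc N))"
        using X(1) near that by (intro dist_near_infdist[OF \<open>convex C\<close>]) auto
      also have "\<dots> < e\<^sup>2"
        using N by simp
      finally show ?thesis
        using \<open>e > 0\<close> by (intro power_less_imp_less_base[of _ 2 e]) auto
    qed
    then show "\<exists>N. \<forall>m\<ge>N. \<forall>n\<ge>N. dist (X m) (X n) < e"
      by blast
  qed
  then obtain p where p: "X \<longlonglongrightarrow> p"
    using Cauchy_convergent convergent_def by blast
  then have "p \<in> C"
    using X(1) \<open>closed C\<close> closed_sequentially by blast
  have "(dist u p)\<^sup>2 \<le> ?d\<^sup>2 + 0"
  proof (rule LIMSEQ_le)
    show "(\<lambda>n. (dist u (X n))\<^sup>2) \<longlonglongrightarrow> (dist u p)\<^sup>2"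
      by (intro tendsto_intros p)
    show "(\<lambda>n. ?d\<^sup>2 + inverse (real (Suc n))) \<longlonglongrightarrow> ?d\<^sup>2 + 0"
      by (intro tendsto_intros LIMSEQ_inverse_real_of_nat)
  qed (use X(2) in auto)
  then have "dist u p \<le> ?d"
    by (intro power2_le_imp_le[OF _ infdist_nonneg]) simp
  then show ?thesis
    using \<open>p \<in> C\<close> infdist_le order_trans by blast
qed

lemma metric_projection_in:
  fixes C :: "'a::{real_inner,complete_space} set"
  assumes "closed C" "convex C" "C \<noteq> {}"
  shows "metric_projection C u \<in> C"
proof -
  have "\<exists>!p. p \<in> C \<and> (\<forall>v\<in>C. dist u p \<le> dist u v)"
    using nearest_point_exists[OF assms, of u] nearest_point_unique[OF assms(2)] by blast
  from theI'[OF this] show ?thesis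
    unfolding metric_projection_def by blast
qed

text \<open>At a point of \<open>C\<close> the least distance is zero and only the point itself
  attains it, whatever the shape of \<open>C\<close>.\<close>

lemma metric_projection_self: "u \<in> C \<Longrightarrow> metric_projection C u = u"
  unfolding metric_projection_def
  by (rule the_equality) (auto dest!: bspec[of C _ u])

lemma nearest_point_orthogonal:
  fixes M :: "'a::real_inner set"
  assumes "subspace M" "p \<in> M" "\<forall>v\<in>M. dist u p \<le> dist u v" "m \<in> M"
  shows "inner (u - p) m = 0"
proof (cases "m = 0")
  case False
  \<comment> \<open>This \<open>t\<close> minimizes the quadratic
    \<open>(norm (u - p - t *\<^sub>R m))\<^sup>2\<close>; the decrease it yields must vanish
    because \<open>p\<close> is nearest.\<close>
  define t where "t = inner (u - p) m / inner m m"
  have "p + t *\<^sub>R m \<in> M"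
    using assms by (simp add: subspace_add subspace_scale)
  then have "(norm (u - p))\<^sup>2 \<le> (norm (u - p - t *\<^sub>R m))\<^sup>2"
    using assms(3) by (force simp: dist_norm diff_diff_eq intro: power_mono)
  also have "\<dots> = (norm (u - p))\<^sup>2 - (inner (u - p) m)\<^sup>2 / inner m m"
  proof -
    have "(norm (x - t *\<^sub>R m))\<^sup>2 = (norm x)\<^sup>2 - 2 * t * inner x m + t\<^sup>2 * inner m m" for x
      unfolding power2_norm_eq_inner
      by (simp add: inner_diff_left inner_diff_right inner_commute power2_eq_square algebra_simps)
    from this[of "u - p"] have "(norm (u - p - t *\<^sub>R m))\<^sup>2
        = (norm (u - p))\<^sup>2 - 2 * t * inner (u - p) m + t\<^sup>2 * inner m m" .
    moreover have "t * inner m m = inner (u - p) m"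
      using False by (simp add: t_def)
    then have "t\<^sup>2 * inner m m = t * inner (u - p) m"
      by (simp add: power2_eq_square)
    moreover have "t * inner (u - p) m = (inner (u - p) m)\<^sup>2 / inner m m"
      by (simp add: t_def power2_eq_square)
    ultimately show ?thesis
      by simp
  qed
  finally have "(inner (u - p) m)\<^sup>2 / inner m m \<le> 0"
    by simp
  moreover have "inner m m > 0"
    using False by simp
  ultimately have "(inner (u - p) m)\<^sup>2 \<le> 0"
    by (simp add: divide_le_0_iff)
  then show ?thesis
    by simp
qed simp

text \<open>Existence comes from the nearest point; two candidates differ by an element of
  \<open>M\<close> that is orthogonal to itself.\<close>

lemma orthogonal_projection:
  fixes M :: "'a::{real_inner,complete_space} set"
  assumes "subspace M" "closed M"
  shows orthogonal_projection_in: "orthogonal_projection M u \<in> M"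
    and orthogonal_projection_orthogonal:
      "m \<in> M \<Longrightarrow> inner (u - orthogonal_projection M u) m = 0"
proof -
  obtain p where "p \<in> M" "\<forall>v\<in>M. dist u p \<le> dist u v"
    using nearest_point_exists[of M u] assms subspace_imp_convex subspace_0 by blast
  then have p: "p \<in> M \<and> (\<forall>m\<in>M. inner (u - p) m = 0)"
    using nearest_point_orthogonal[OF assms(1)] by blast
  have "q = p" if q: "q \<in> M \<and> (\<forall>m\<in>M. inner (u - q) m = 0)" for q
  proof -
    have "q - p \<in> M"
      using p q assms(1) by (simp add: subspace_diff)
    then have "inner (u - p) (q - p) - inner (u - q) (q - p) = 0"
      using p q by simp
    then have "inner (q - p) (q - p) = 0"
      by (simp add: inner_diff_left)
    then show ?thesis
      by simp
  qed
  with p have "orthogonal_projection M u = p"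
    unfolding orthogonal_projection_def by (rule the_equality)
  then show "orthogonal_projection M u \<in> M"
    and "m \<in> M \<Longrightarrow> inner (u - orthogonal_projection M u) m = 0"
    using p by auto
qed

lemma riesz_representation:
  fixes f :: "'a::{real_inner,complete_space} \<Rightarrow> real"
  assumes "bounded_linear f"
  shows "\<exists>g. \<forall>x. f x = inner x g"
proof (cases "\<forall>x. f x = 0")
  case True
  then show ?thesis
    by (intro exI[of _ 0]) simp
next
  case False
  interpret bounded_linear f by fact
  let ?K = "{x. f x = 0}"
  obtain x\<^sub>0 where "f x\<^sub>0 \<noteq> 0"
    using False by blast
  have K: "subspace ?K" "closed ?K"
    using linear_continuous_on[OF assms, of UNIV]
    by (auto simp: subspace_def zero add scaleR intro!: closed_Collect_eq continuous_intros)
  \<comment> \<open>\<open>z\<close> is orthogonal to the kernel, and \<open>f z\<close> is nonzero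
    because \<open>f\<close> vanishes on the projection removed from
    \<open>x\<^sub>0\<close>.\<close>
  define z where "z = x\<^sub>0 - orthogonal_projection ?K x\<^sub>0"
  have "f z = f x\<^sub>0"
    using orthogonal_projection_in[OF K, of x\<^sub>0] by (simp add: z_def diff)
  then have "f z \<noteq> 0" "z \<noteq> 0"
    using \<open>f x\<^sub>0 \<noteq> 0\<close> by (auto simp: zero)
  have "f x = inner x ((f z / inner z z) *\<^sub>R z)" for x
  proof -
    \<comment> \<open>Removing the right multiple of \<open>z\<close> puts \<open>x\<close> into the
      kernel; orthogonality to \<open>z\<close> then determines \<open>f x\<close>.\<close>
    have "f (x - (f x / f z) *\<^sub>R z) = 0"
      using \<open>f z \<noteq> 0\<close> by (simp add: diff scaleR)
    then have "inner z (x - (f x / f z) *\<^sub>R z) = 0"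
      using orthogonal_projection_orthogonal[OF K] by (simp add: z_def)
    then have "inner x z = f x / f z * inner z z"
      by (simp add: inner_diff_right inner_commute)
    then show ?thesis
      using \<open>f z \<noteq> 0\<close> \<open>z \<noteq> 0\<close> by simp
  qed
  then show ?thesis
    by blast
qed


section \<open>Gradients\<close>

text \<open>Justifies the definite description in \<open>gradient\<close>: existence by Riesz,
  uniqueness by testing two representers against their difference.\<close>

lemma GDERIV_gradient:
  fixes f :: "'a::{real_inner,complete_space} \<Rightarrow> real"
  assumes "f differentiable at u"
  shows "GDERIV f u :> gradient f u"
proof -
  obtain D where D: "(f has_derivative D) (at u)"
    using assms by (auto simp: differentiable_def)
  then obtain g where "\<forall>x. D x = inner x g"
    using riesz_representation has_derivative_bounded_linear by blast
  then have "D = (\<lambda>x. inner x g)"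
    by auto
  with D have g: "GDERIV f u :> g"
    by (simp add: gderiv_def)
  have "g' = g" if "GDERIV f u :> g'" for g'
  proof -
    have "(\<lambda>x. inner x g') = (\<lambda>x. inner x g)"
      using that g unfolding gderiv_def by (rule has_derivative_unique)
    then have "inner (g' - g) g' = inner (g' - g) g"
      by (rule fun_cong)
    then have "inner (g' - g) (g' - g) = 0"
      by (simp add: inner_diff_right)
    then show ?thesis
      by simp
  qed
  then show ?thesis
    unfolding gradient_def using g by (rule theI[where P = "\<lambda>g. GDERIV f u :> g", rotated])
qed

text \<open>Difference quotients within \<open>M\<close> involve only directions in
  \<open>M\<close>, and there \<open>g\<close> and its orthogonal projection have the same inner
  products.\<close>

lemma subspace_gradient_eq:
  fixes f :: "'a::{real_inner,complete_space} \<Rightarrow> real"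
  assumes M: "subspace M" "closed M" and "u \<in> M" and g: "GDERIV f u :> g"
  shows "subspace_gradient M f u = orthogonal_projection M g"
  unfolding subspace_gradient_def
proof (rule the_equality)
  let ?p = "orthogonal_projection M g"
  have p: "?p \<in> M"
    by (rule orthogonal_projection_in[OF M])
  have "(f has_derivative (\<lambda>d. inner d g)) (at u within M)"
    using g by (simp add: gderiv_def has_derivative_at_withinI)
  then have "((\<lambda>y. (f y - (f u + inner (y - u) g)) /\<^sub>R norm (y - u)) \<longlongrightarrow> 0) (at u within M)"
    by (simp add: has_derivative_within divide_inverse mult.commute)
  moreover have "inner (y - u) g = inner (y - u) ?p" if "y \<in> M" for y
    using orthogonal_projection_orthogonal[OF M subspace_diff[OF M(1) that \<open>u \<in> M\<close>], of g]
    by (simp add: inner_diff_left[of g] inner_commute[of "y - u"])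
  ultimately have
    "((\<lambda>y. (f y - (f u + inner (y - u) ?p)) /\<^sub>R norm (y - u)) \<longlongrightarrow> 0) (at u within M)"
    by (elim Lim_transform_eventually) (auto simp: eventually_at_filter)
  then have der: "(f has_derivative (\<lambda>d. inner d ?p)) (at u within M)"
    by (simp add: has_derivative_within bounded_linear_inner_left divide_inverse mult.commute)
  with p show "?p \<in> M \<and> (f has_derivative (\<lambda>d. inner d ?p)) (at u within M)" ..
  fix q assume q: "q \<in> M \<and> (f has_derivative (\<lambda>d. inner d q)) (at u within M)"
  have dM: "q - ?p \<in> M"
    using p q M(1) by (simp add: subspace_diff)
  \<comment> \<open>Derivatives within a subspace are not unique in general. Restricting to the line
    through \<open>u\<close> in direction \<open>q - ?p\<close> gives a function of a real variable,
    where uniqueness holds.\<close>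
  let ?c = "\<lambda>t::real. u + t *\<^sub>R (q - ?p)"
  have line: "range ?c \<subseteq> M"
    using dM \<open>u \<in> M\<close> M(1) by (auto intro!: subspace_add subspace_scale)
  have "((\<lambda>x. f x - f x) has_derivative (\<lambda>d. inner d q - inner d ?p)) (at u within M)"
    using q der by (intro has_derivative_diff) auto
  then have der0:
    "((\<lambda>x. 0::real) has_derivative (\<lambda>d. inner d q - inner d ?p)) (at (?c 0) within range ?c)"
    using line by (simp add: has_derivative_subset)
  have "(?c has_derivative (\<lambda>t. t *\<^sub>R (q - ?p))) (at 0)"
    by (auto intro!: derivative_eq_intros)
  from has_derivative_in_compose[OF this der0]
  have "((\<lambda>t. 0::real) has_derivative
      (\<lambda>t. inner (t *\<^sub>R (q - ?p)) q - inner (t *\<^sub>R (q - ?p)) ?p)) (at 0)" .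
  then have "(\<lambda>t::real. inner (t *\<^sub>R (q - ?p)) q - inner (t *\<^sub>R (q - ?p)) ?p) = (\<lambda>t. 0)"
    by (rule has_derivative_unique) simp
  then have "inner (1 *\<^sub>R (q - ?p)) q - inner (1 *\<^sub>R (q - ?p)) ?p = 0"
    by (rule fun_cong)
  then have "inner (q - ?p) (q - ?p) = 0"
    by (simp only: inner_diff_right scaleR_one)
  then show "q = ?p"
    by simp
qed

text \<open>Allows the discrete gradient to be traded for the full one in inner products with
  elements of \<open>M\<close>.\<close>

lemma inner_subspace_gradient:
  fixes f :: "'a::{real_inner,complete_space} \<Rightarrow> real"
  assumes M: "subspace M" "closed M" and "u \<in> M" "d \<in> M" and f: "f differentiable at u"
  shows "inner (subspace_gradient M f u) d = inner (gradient f u) d"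
  using subspace_gradient_eq[OF M \<open>u \<in> M\<close> GDERIV_gradient[OF f]]
    orthogonal_projection_orthogonal[OF M \<open>d \<in> M\<close>, of "gradient f u"]
  by (simp add: inner_diff_left)

lemma C1_into_differentiable: "C1_into f V Z \<Longrightarrow> u \<in> V \<Longrightarrow> f differentiable at u"
  unfolding C1_into_def differentiable_def by blast

lemma reduced_objective_differentiable:
  assumes "S differentiable at u" and "J differentiable at (S u, u)"
  shows "reduced_objective J S differentiable at u"
proof -
  have "(\<lambda>x. (S x, x)) differentiable at u"
    using assms(1) by (auto simp: differentiable_def intro!: has_derivative_Pair has_derivative_ident)
  then have "J \<circ> (\<lambda>x. (S x, x)) differentiable at u"
    using assms(2) by (intro differentiable_chain_at)
  moreover have "J \<circ> (\<lambda>x. (S x, x)) = reduced_objective J S"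
    by (simp add: fun_eq_iff reduced_objective_def)
  ultimately show ?thesis
    by simp
qed


section \<open>The gap estimate\<close>

lemma effective_domain_plus_indicator:
  "effective_domain M (plus_indicator \<phi> C) = M \<inter> C"
  by (auto simp: effective_domain_def plus_indicator_def indicator_fun_def split: if_splits)

lemma inner_le_mult:
  fixes x y :: "'a::real_inner"
  assumes "norm x \<le> a" "norm y \<le> b"
  shows "inner x y \<le> a * b"
proof -
  have "inner x y \<le> norm x * norm y"
    by (rule norm_cauchy_schwarz)
  also have "\<dots> \<le> a * b"
    using assms order_trans[OF norm_ge_zero assms(1)] by (intro mult_mono) auto
  finally show ?thesis .
qed

theorem theorem3:
  fixes \<phi> :: "'u::{real_inner,complete_space} \<Rightarrow> real"
    and Uad VU WU :: "'u set"
    and J :: "'y::banach \<times> 'u \<Rightarrow> real"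
    and S :: "'u \<Rightarrow> 'y"
    and Uh :: "real \<Rightarrow> 'u set"
    and Yh :: "real \<Rightarrow> 'y set"
    and Sh :: "real \<Rightarrow> 'u \<Rightarrow> 'y"
    and \<iota> :: "'w::banach \<Rightarrow> 'u"
    and \<rho>\<pi> \<rho>J \<rho>proj :: "real \<Rightarrow> real"
    and LJ lJ L\<phi> :: real
  defines "\<pi> \<equiv> \<lambda>h. orthogonal_projection (Uh h)"
    and "\<psi> \<equiv> plus_indicator \<phi> Uad"
    and "\<psi>h \<equiv> \<lambda>h. plus_indicator \<phi> (orthogonal_projection (Uh h) ` Uad)"
    and "Jhat \<equiv> reduced_objective J S"
    and "Jhath \<equiv> \<lambda>h. reduced_objective J (Sh h)"
  assumes "separable_space (euclidean :: 'u topology)"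
    and "separable_space (euclidean :: 'y topology)"
    and "convex_on UNIV \<phi>"
    and "closed Uad" and "convex Uad" and "bounded Uad" and "Uad \<noteq> {}"
    and "proper_on UNIV \<psi>" and "lower_semicontinuous_on UNIV \<psi>" and "ereal_convex_on UNIV \<psi>"
    and "open VU" and "effective_domain UNIV \<psi> \<subseteq> VU"
    and "C1_into J UNIV UNIV" and "C1_into S VU UNIV"
    and "\<And>h. h > 0 \<Longrightarrow> subspace (Uh h) \<and> closed (Uh h)"
    and "\<And>h. h > 0 \<Longrightarrow> subspace (Yh h)"
    and "\<And>h. h > 0 \<Longrightarrow> proper_on (Uh h) (\<psi>h h) \<and> lower_semicontinuous_on (Uh h) (\<psi>h h)
                      \<and> ereal_convex_on (Uh h) (\<psi>h h)"
    and "\<And>h. h > 0 \<Longrightarrow> effective_domain (Uh h) (\<psi>h h) \<subseteq> VU"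
    and "\<And>h. h > 0 \<Longrightarrow> C1_into (Sh h) VU (Yh h)"
    and "\<And>h u. h > 0 \<Longrightarrow> \<phi> (\<pi> h u) \<le> \<phi> u"
    \<comment> \<open>\<open>'w\<close> is identified with its image under \<open>\<iota>\<close>, a dense linear subspace of \<open>'u\<close>. Its norm
       is scaled such that the embedding has norm at most 1; the bound \<open>lJ\<close> then also bounds
       the gradients in \<open>'u\<close>, without which the estimate fails in general.\<close>
    and "reflexive_space TYPE('w)"
    and "bounded_linear \<iota>" and "inj \<iota>" and "closure (range \<iota>) = UNIV"
    and "\<And>w. norm (\<iota> w) \<le> norm w"
    and "rate_function \<rho>\<pi>"
    and "\<And>h w. h > 0 \<Longrightarrow> norm (\<pi> h (\<iota> w) - \<iota> w) \<le> \<rho>\<pi> h * norm w"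
    and "bounded WU" and "WU \<subseteq> VU"
    and "effective_domain UNIV \<psi> \<subseteq> WU"
    and "\<And>h. h > 0 \<Longrightarrow> effective_domain (Uh h) (\<psi>h h) \<subseteq> WU"
    and "LJ > 0" and "LJ-lipschitz_on WU (gradient Jhat)"
    and "lJ > 0"
    and "\<And>h v. h > 0 \<Longrightarrow> v \<in> WU \<inter> Uh h \<Longrightarrow> \<exists>w. \<iota> w = gradient Jhat v \<and> norm w \<le> lJ"
    and "rate_function \<rho>J"
    and "\<And>h v. h > 0 \<Longrightarrow> v \<in> WU \<inter> Uh h \<Longrightarrow>
           norm (gradient (Jhath h) v - gradient Jhat v) \<le> \<rho>J h"
    and "rate_function \<rho>proj"
    and "\<And>h v. h > 0 \<Longrightarrow> v \<in> Uh h \<Longrightarrow>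
           norm (metric_projection Uad v - metric_projection (\<pi> h ` Uad) v) \<le> \<rho>proj h"
    and "L\<phi>-lipschitz_on WU \<phi>"
  shows "\<forall>h>0. \<forall>uh \<in> WU \<inter> Uh h.
           \<comment> \<open>For \<open>uh\<close> outside the image of \<open>Uad\<close> under \<open>\<pi> h\<close>, \<open>discrete_gap\<close> can be
             negative and the estimate fails in general.\<close>
           uh \<in> effective_domain (Uh h) (\<psi>h h) \<longrightarrow>
           gap Jhat \<phi> Uad (metric_projection Uad uh)
             \<le> discrete_gap (Uh h) (Jhath h) \<phi> Uad uh
               + ereal ((lJ + L\<phi>) * \<rho>proj h
                   + diameter WU * (LJ * \<rho>proj h + \<rho>\<pi> h * lJ + \<rho>J h))"
proof (intro allI impI ballI)
  note Uad_closed_convex = assms(9,10,12)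
    and J = assms(18) and Uh = assms(20) and Sh = assms(24) and \<phi>_\<pi> = assms(25)
    and \<iota>_le = assms(30) and \<rho>\<pi> = assms(31) and \<pi>_approx = assms(32)
    and bounded_WU = assms(33) and WU_VU = assms(34)
    and dom_WU = assms(35) and domh_WU = assms(36)
    and LJ_pos = assms(37) and LJ = assms(38) and grad_bound = assms(40)
    and grad_h = assms(42) and proj = assms(44) and L\<phi> = assms(45)
  fix h :: real and uh
  assume "h > 0" and uh: "uh \<in> WU \<inter> Uh h" and dom: "uh \<in> effective_domain (Uh h) (\<psi>h h)"
  have M: "subspace (Uh h)" "closed (Uh h)"
    using Uh \<open>h > 0\<close> by auto
  have Uad: "Uad \<subseteq> WU"
    using dom_WU by (simp add: \<psi>_def effective_domain_plus_indicator)
  have "\<pi> h v \<in> Uh h" for v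
    unfolding \<pi>_def by (rule orthogonal_projection_in[OF M])
  then have domh: "effective_domain (Uh h) (\<psi>h h) = \<pi> h ` Uad"
    by (auto simp: \<psi>h_def effective_domain_plus_indicator \<pi>_def)
  then have \<pi>Uad: "\<pi> h v \<in> WU \<inter> Uh h" if "v \<in> Uad" for v
    using domh_WU[OF \<open>h > 0\<close>] that \<open>\<And>v. \<pi> h v \<in> Uh h\<close> by blast
  define ub where "ub = metric_projection Uad uh"
  have "ub \<in> Uad"
    unfolding ub_def using Uad_closed_convex by (intro metric_projection_in) auto
  have ub: "norm (ub - uh) \<le> \<rho>proj h"
    using proj[OF \<open>h > 0\<close>, of uh] uh dom domh
    by (simp add: ub_def metric_projection_self)
  define g where "g = gradient Jhat uh"
  define gh where "gh = gradient (Jhath h) uh"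
  obtain w where w: "\<iota> w = g" "norm w \<le> lJ"
    using grad_bound[OF \<open>h > 0\<close> uh] by (auto simp: g_def)
  \<comment> \<open>The embedding has norm at most 1, so the bound on \<open>w\<close> carries over
    to \<open>'u\<close>.\<close>
  have g: "norm g \<le> lJ"
    using \<iota>_le[of w] w by simp
  have "\<rho>\<pi> h * norm w \<le> \<rho>\<pi> h * lJ"
    using \<rho>\<pi> \<open>h > 0\<close> w(2) by (intro mult_left_mono) (auto simp: rate_function_def)
  then have \<pi>g: "norm (\<pi> h g - g) \<le> \<rho>\<pi> h * lJ"
    using \<pi>_approx[OF \<open>h > 0\<close>, of w] w(1) by simp
  have diam: "norm (x - y) \<le> diameter WU" if "x \<in> WU" "y \<in> WU" for x y
    using diameter_bounded_bound[OF bounded_WU that] by (simp add: dist_norm)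
  have "uh \<in> VU"
    using uh WU_VU by blast
  then have diff: "Jhath h differentiable at uh"
    unfolding Jhath_def
    using J Sh[OF \<open>h > 0\<close>]
    by (intro reduced_objective_differentiable) (auto intro: C1_into_differentiable)
  let ?E = "(lJ + L\<phi>) * \<rho>proj h + diameter WU * (LJ * \<rho>proj h + \<rho>\<pi> h * lJ + \<rho>J h)"
  show "gap Jhat \<phi> Uad (metric_projection Uad uh)
      \<le> discrete_gap (Uh h) (Jhath h) \<phi> Uad uh + ereal ?E"
    unfolding gap_def ub_def[symmetric]
  proof (rule SUP_least)
    fix v assume v: "v \<in> Uad"
    let ?G = "gradient Jhat ub"
    have "norm (?G - g) \<le> LJ * norm (ub - uh)"
      using lipschitz_onD[OF LJ, of ub uh] \<open>ub \<in> Uad\<close> Uad uh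
      by (auto simp: g_def dist_norm)
    also have "\<dots> \<le> LJ * \<rho>proj h"
      using ub LJ_pos by simp
    finally have 1: "inner (?G - g) (ub - v) \<le> LJ * \<rho>proj h * diameter WU"
      using diam[of ub v] \<open>ub \<in> Uad\<close> v Uad by (intro inner_le_mult) auto
    have 2: "inner g (ub - uh) \<le> lJ * \<rho>proj h"
      using g ub by (rule inner_le_mult)
    have "\<phi> ub - \<phi> uh \<le> L\<phi> * norm (ub - uh)"
      using lipschitz_onD[OF L\<phi>, of ub uh] \<open>ub \<in> Uad\<close> Uad uh
      by (auto simp: dist_norm)
    also have "\<dots> \<le> L\<phi> * \<rho>proj h"
      using ub lipschitz_on_nonneg[OF L\<phi>] by (rule mult_left_mono)
    finally have 3: "\<phi> ub - \<phi> uh \<le> L\<phi> * \<rho>proj h" .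
    have dM: "uh - \<pi> h v \<in> Uh h"
      using uh \<pi>Uad[OF v] M(1) by (simp add: subspace_diff)
    \<comment> \<open>Two orthogonalities are combined: \<open>v - \<pi> h v\<close> against
      \<open>\<pi> h g\<close>, and \<open>g - \<pi> h g\<close> against
      \<open>uh - \<pi> h v\<close>.\<close>
    have "inner g (\<pi> h v - v) = inner (g - \<pi> h g) (uh - v)"
    proof -
      have "inner (\<pi> h g) (v - \<pi> h v) = 0" "inner (g - \<pi> h g) (uh - \<pi> h v) = 0"
        using orthogonal_projection_orthogonal[OF M orthogonal_projection_in[OF M], of v g]
          orthogonal_projection_orthogonal[OF M dM, of g]
        by (simp_all add: \<pi>_def inner_commute)
      then show ?thesis
        by (simp add: inner_diff_left inner_diff_right)
    qed
    also have "\<dots> \<le> \<rho>\<pi> h * lJ * diameter WU"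
      using \<pi>g diam[of uh v] uh v Uad by (intro inner_le_mult) (auto simp: norm_minus_commute)
    finally have 4: "inner g (\<pi> h v - v) \<le> \<rho>\<pi> h * lJ * diameter WU" .
    have 5: "inner (g - gh) (uh - \<pi> h v) \<le> \<rho>J h * diameter WU"
      using grad_h[OF \<open>h > 0\<close> uh] diam[of uh "\<pi> h v"] uh \<pi>Uad[OF v]
      by (intro inner_le_mult) (auto simp: g_def gh_def norm_minus_commute)
    have 6: "inner (subspace_gradient (Uh h) (Jhath h) uh) (uh - \<pi> h v) = inner gh (uh - \<pi> h v)"
      unfolding gh_def using M uh dM diff by (intro inner_subspace_gradient) auto
    \<comment> \<open>Telescoping: 1, 2, 4 and 5 bound the first four summands, and 6 turns the last
      into the discrete gradient term. The \<phi> terms are handled by 3 and by \<phi> not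
      increasing under \<open>\<pi> h\<close>.\<close>
    have "inner ?G (ub - v) = inner (?G - g) (ub - v) + inner g (ub - uh) + inner g (\<pi> h v - v)
        + inner (g - gh) (uh - \<pi> h v) + inner gh (uh - \<pi> h v)"
      by (simp add: inner_diff_left inner_diff_right)
    then have "inner ?G (ub - v) + \<phi> ub - \<phi> v
        \<le> inner (subspace_gradient (Uh h) (Jhath h) uh) (uh - \<pi> h v) + \<phi> uh - \<phi> (\<pi> h v) + ?E"
      using 1 2 3 4 5 6 \<phi>_\<pi>[OF \<open>h > 0\<close>, of v] by (simp add: algebra_simps)
    then have "ereal (inner ?G (ub - v) + \<phi> ub - \<phi> v)
        \<le> ereal (inner (subspace_gradient (Uh h) (Jhath h) uh) (uh - \<pi> h v) + \<phi> uh - \<phi> (\<pi> h v))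
          + ereal ?E"
      by simp
    \<comment> \<open>\<open>\<pi> h v\<close> is an admissible competitor in the supremum defining
      the discrete gap.\<close>
    also have "\<dots> \<le> discrete_gap (Uh h) (Jhath h) \<phi> Uad uh + ereal ?E"
      unfolding discrete_gap_def using v by (intro add_right_mono SUP_upper) (auto simp: \<pi>_def)
    finally show "ereal (inner ?G (ub - v) + \<phi> ub - \<phi> v)
        \<le> discrete_gap (Uh h) (Jhath h) \<phi> Uad uh + ereal ?E" .
  qed
qed

end
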